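(* Let $K\subset\mathbb{R}^n$ be a non-empty closed set with medial axis $M_K$. Then for every $\lambda>0$ and every $x\in M_K$, $$\sin^2(\theta_x/2)\,\mathrm{dist}^2(x;K)\leq M_\lambda(x;K)\leq\mathrm{dist}^2(x;K),$$ where $\theta_x$ is the separation angle at $x$.
   Context: $|\cdot|$ is the Euclidean norm on $\mathbb{R}^n$ and $\mathrm{dist}(x;E)=\inf\{|x-y|: y\in E\}$ for non-empty $E$. For a non-empty closed set $K\subset\mathbb{R}^n$, the medial axis $M_K$ is the set of points $x\in\mathbb{R}^n\setminus K$ for which there are at least two different points $y_1,y_2\in K$ with $\mathrm{dist}(x;K)=|x-y_1|=|x-y_2|$. Let $K(x)=\{y\in K:\ |y-x|=\mathrm{dist}(x;K)\}$ (a compact set). For $x\in M_K$ and $y_1,y_2\in K(x)$ let $\angle[y_1-x,y_2-x]=\cos^{-1}\frac{(y_1-x)\cdot(y_2-x)}{|y_1-x||y_2-x|}\in[0,\pi]$, and define the separation angle $\theta_x=\max\{\angle[y_1-x,y_2-x]:\ y_1,y_2\in K(x)\}$. For a continuous function $f:\mathbb{R}^n\to\mathbb{R}$ bounded below, $\mathrm{co}[f]$ denotes the convex envelope, i.e. the largest convex function not greater than $f$. For $\lambda>0$ the lower compensated convex transform is $C^l_\lambda(f)(x)=\mathrm{co}[f+\lambda|\cdot|^2](x)-\lambda|x|^2$. The quadratic multiscale medial axis map of $K$ with scale $\lambda>0$ is $M_\lambda(x;K)=(1+\lambda)\big(\mathrm{dist}^2(x;K)-C^l_\lambda(\mathrm{dist}^2(\cdot;K))(x)\big)$.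 *)

theory Defs
  imports "HOL-Analysis.Analysis"
begin

definition nearest_points :: "'a::euclidean_space set \<Rightarrow> 'a \<Rightarrow> 'a set" where
  "nearest_points K x = {y \<in> K. dist y x = infdist x K}"

definition medial_axis :: "'a::euclidean_space set \<Rightarrow> 'a set" where
  "medial_axis K = {x. x \<notin> K \<and>
     (\<exists>y1\<in>K. \<exists>y2\<in>K. y1 \<noteq> y2 \<and> infdist x K = dist x y1 \<and> infdist x K = dist x y2)}"

definition vec_angle :: "'a::euclidean_space \<Rightarrow> 'a \<Rightarrow> real" where
  "vec_angle u v = arccos ((u \<bullet> v) / (norm u * norm v))"

text \<open>The set of angles is in general infinite, so the finite-set operator \<open>Max\<close> does not
  apply. The maximum exists when \<open>K\<close> is closed and non-empty and \<open>x \<notin> K\<close>, because the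
  set of nearest points is then compact and non-empty.\<close>

definition separation_angle :: "'a::euclidean_space set \<Rightarrow> 'a \<Rightarrow> real" where
  "separation_angle K x = (GREATEST \<alpha>. \<exists>y1\<in>nearest_points K x. \<exists>y2\<in>nearest_points K x.
     \<alpha> = vec_angle (y1 - x) (y2 - x))"

text \<open>Functions are ordered pointwise. The greatest element exists whenever \<open>f\<close> is bounded
  below: it is the pointwise supremum of all convex minorants.\<close>

definition convex_envelope :: "('a::euclidean_space \<Rightarrow> real) \<Rightarrow> 'a \<Rightarrow> real" where
  "convex_envelope f = (GREATEST g. convex_on UNIV g \<and> g \<le> f)"

definition lower_transform :: "real \<Rightarrow> ('a::euclidean_space \<Rightarrow> real) \<Rightarrow> 'a \<Rightarrow> real" where
  "lower_transform \<mu> f x =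
     convex_envelope (\<lambda>y. f y + \<mu> * (norm y)\<^sup>2) x - \<mu> * (norm x)\<^sup>2"

definition medial_axis_map :: "real \<Rightarrow> 'a::euclidean_space set \<Rightarrow> 'a \<Rightarrow> real" where
  "medial_axis_map \<mu> K x =
     (1 + \<mu>) * ((infdist x K)\<^sup>2 - lower_transform \<mu> (\<lambda>y. (infdist y K)\<^sup>2) x)"

end

theory Submission
  imports Defs
begin

text \<open>Write \<open>d\<close> for the distance from \<open>x\<close> to \<open>K\<close>. For the upper bound,
  the triangle inequality and Cauchy--Schwarz give
  \<open>dist\<^sup>2(y; K) + \<mu> |y - x|\<^sup>2 \<ge> \<mu> d\<^sup>2 / (1 + \<mu>)\<close>, so the function
  \<open>y \<mapsto> dist\<^sup>2(y; K) + \<mu> |y|\<^sup>2\<close> has an affine minorant which is large enough at \<open>x\<close>.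

  For the lower bound, take nearest points \<open>y1\<close>, \<open>y2\<close> realizing the separation angle and
  put \<open>a = (y1 - y2) / 2\<close>, which has length \<open>d sin (\<theta> / 2)\<close>. Evaluating the convex envelope at
  \<open>x\<close> as the midpoint of \<open>x \<plusminus> a / (1 + \<mu>)\<close>, and estimating the distance to \<open>K\<close> by the
  distance to \<open>y1\<close> and \<open>y2\<close> respectively, gives the claim.\<close>

text \<open>The pointwise supremum of all convex minorants is again convex and stays below
  \<open>f\<close>, so it is the greatest one. The single minorant \<open>h\<close> keeps the family
  non-empty, and the values of \<open>f\<close> bound it above at each point.\<close>

lemma convex_envelope_is_greatest:
  fixes f :: "'a::euclidean_space \<Rightarrow> real"
  assumes "convex_on UNIV h" "h \<le> f"
  shows convex_on_convex_envelope: "convex_on UNIV (convex_envelope f)"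
    and convex_envelope_le: "convex_envelope f \<le> f"
    and convex_envelope_greatest: "h \<le> convex_envelope f"
proof -
  define H where "H = {g. convex_on UNIV g \<and> g \<le> f}"
  define s where "s = (\<lambda>x. SUP g\<in>H. g x)"
  have ne: "H \<noteq> {}" using assms by (auto simp: H_def)
  have le: "g x \<le> f x" if "g \<in> H" for g x using that by (auto simp: H_def le_fun_def)
  have bdd: "bdd_above ((\<lambda>g. g x) ` H)" for x using le by (rule bdd_aboveI2)
  have upper: "g x \<le> s x" if "g \<in> H" for g x
    unfolding s_def using cSUP_upper[OF that bdd] by simp
  have least: "s x \<le> c" if "\<And>g. g \<in> H \<Longrightarrow> g x \<le> c" for x c
    unfolding s_def using ne that by (rule cSUP_least)
  have "convex_on UNIV s"
  proof (rule convex_onI)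
    fix t :: real and x y :: 'a
    assume t: "0 < t" "t < 1"
    show "s ((1 - t) *\<^sub>R x + t *\<^sub>R y) \<le> (1 - t) * s x + t * s y"
    proof (rule least)
      fix g assume g: "g \<in> H"
      then have "g ((1 - t) *\<^sub>R x + t *\<^sub>R y) \<le> (1 - t) * g x + t * g y"
        using t by (intro convex_onD) (auto simp: H_def)
      also have "\<dots> \<le> (1 - t) * s x + t * s y"
        using t upper[OF g] by (intro add_mono mult_left_mono) auto
      finally show "g ((1 - t) *\<^sub>R x + t *\<^sub>R y) \<le> (1 - t) * s x + t * s y" .
    qed
  qed simp
  moreover have "s \<le> f"
    unfolding le_fun_def using least le by blast
  moreover have "g \<le> s" if "convex_on UNIV g \<and> g \<le> f" for g
    using upper that by (auto simp: le_fun_def H_def)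
  ultimately have "convex_envelope f = s" "h \<le> s"
    unfolding convex_envelope_def using assms by (auto intro!: Greatest_equality)
  then show "convex_on UNIV (convex_envelope f)" "convex_envelope f \<le> f" "h \<le> convex_envelope f"
    using \<open>convex_on UNIV s\<close> \<open>s \<le> f\<close> by auto
qed

lemma compact_nearest_points:
  assumes "closed K"
  shows "compact (nearest_points K x)"
proof -
  have "nearest_points K x = K \<inter> sphere x (infdist x K)"
    by (auto simp: nearest_points_def dist_commute)
  then show ?thesis using assms by (simp add: closed_Int_compact)
qed

lemma abs_cosine_le_1: "\<bar>(u \<bullet> v) / (norm u * norm v)\<bar> \<le> 1"
  using Cauchy_Schwarz_ineq2[of u v] by (cases "u = 0 \<or> v = 0") (auto simp: abs_mult divide_simps)

text \<open>The angle is continuous on the compact set of pairs of nearest points, because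
  \<open>x \<notin> K\<close> keeps the denominator away from zero; hence the maximum in
  \<open>separation_angle\<close> exists.\<close>

lemma separation_angle_attained:
  assumes "closed K" "K \<noteq> {}" "x \<notin> K"
  obtains y1 y2 where "y1 \<in> nearest_points K x" "y2 \<in> nearest_points K x"
    "separation_angle K x = vec_angle (y1 - x) (y2 - x)"
proof -
  let ?N = "nearest_points K x"
  let ?g = "\<lambda>p. vec_angle (fst p - x) (snd p - x)"
  have "?N \<noteq> {}"
    unfolding nearest_points_def using infdist_attains_inf[OF assms(1,2), of x]
    by (metis (mono_tags, lifting) dist_commute empty_iff mem_Collect_eq)
  moreover have "y \<noteq> x" if "y \<in> ?N" for y
    using that assms(3) by (auto simp: nearest_points_def)
  then have "continuous_on (?N \<times> ?N)
      (\<lambda>p. ((fst p - x) \<bullet> (snd p - x)) / (norm (fst p - x) * norm (snd p - x)))"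
    by (intro continuous_intros) auto
  then have "continuous_on (?N \<times> ?N) ?g"
    unfolding vec_angle_def
    by (rule continuous_on_arccos) (meson abs_cosine_le_1 abs_le_iff minus_le_iff)
  moreover have "compact (?N \<times> ?N)"
    by (intro compact_Times compact_nearest_points assms)
  ultimately obtain p where p: "p \<in> ?N \<times> ?N" "\<forall>q \<in> ?N \<times> ?N. ?g q \<le> ?g p"
    using continuous_attains_sup[of "?N \<times> ?N" ?g] by blast
  then have "separation_angle K x = ?g p"
    unfolding separation_angle_def mem_Times_iff by (intro Greatest_equality) (blast, force)
  with p that show ?thesis by auto
qed

text \<open>Law of cosines for an isosceles triangle, combined with cos t = 1 - 2
  sin^2(t/2).\<close>

lemma norm_diff_sq_eq_sin_half_vec_angle:
  assumes "norm u = d" "norm v = d"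
  shows "(norm (u - v))\<^sup>2 = 4 * (sin (vec_angle u v / 2))\<^sup>2 * d\<^sup>2"
proof (cases "d = 0")
  case False
  have "cos (vec_angle u v) = (u \<bullet> v) / d\<^sup>2"
    using cos_arccos_abs[OF abs_cosine_le_1[of u v]] assms
    by (simp add: vec_angle_def power2_eq_square)
  then have "u \<bullet> v = (1 - 2 * (sin (vec_angle u v / 2))\<^sup>2) * d\<^sup>2"
    using cos_double_sin[of "vec_angle u v / 2"] False
    by (simp add: nonzero_divide_eq_eq)
  moreover have "(norm (u - v))\<^sup>2 = 2 * d\<^sup>2 - 2 * (u \<bullet> v)"
    using assms dot_norm_neg[of u v] by (simp add: field_simps)
  ultimately show ?thesis by (simp add: algebra_simps)
qed (use assms in auto)

lemma infdist_sq_add_ge: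
  assumes "\<mu> > 0"
  shows "\<mu> / (1 + \<mu>) * (infdist x K)\<^sup>2 \<le> (infdist y K)\<^sup>2 + \<mu> * (dist x y)\<^sup>2"
proof -
  have "(infdist x K)\<^sup>2 \<le> (infdist y K + dist x y)\<^sup>2"
    by (intro power_mono infdist_triangle infdist_nonneg)
  also have "\<mu> * \<dots> \<le> (1 + \<mu>) * ((infdist y K)\<^sup>2 + \<mu> * (dist x y)\<^sup>2)"
    \<comment> \<open>The right side minus the left side is exactly this square.\<close>
    using zero_le_power2[of "infdist y K - \<mu> * dist x y"]
    by (simp add: power2_eq_square algebra_simps)
  finally show ?thesis using assms by (simp add: divide_simps mult.commute)
qed

text \<open>Expanding \<open>\<mu> * (dist x y)\<^sup>2\<close> in the previous bound, the terms in
  \<open>(norm y)\<^sup>2\<close> cancel and what remains is affine in \<open>y\<close>.\<close>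

lemma affine_minorant:
  fixes x :: "'a::euclidean_space" and K :: "'a set"
  assumes "\<mu> > 0"
  defines "h \<equiv> \<lambda>y. \<mu> / (1 + \<mu>) * (infdist x K)\<^sup>2 - \<mu> * (norm x)\<^sup>2 + (2 * \<mu>) *\<^sub>R x \<bullet> y"
  shows "convex_on UNIV h" and "h \<le> (\<lambda>y. (infdist y K)\<^sup>2 + \<mu> * (norm y)\<^sup>2)"
proof -
  show "convex_on UNIV h"
    by (rule convex_onI) (auto simp: h_def inner_add_right algebra_simps simp flip: add_divide_distrib)
  have "h y = \<mu> / (1 + \<mu>) * (infdist x K)\<^sup>2 - \<mu> * (dist x y)\<^sup>2 + \<mu> * (norm y)\<^sup>2" for y
    by (simp add: h_def dist_norm power2_norm_eq_inner inner_diff inner_commute algebra_simps)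
  then show "h \<le> (\<lambda>y. (infdist y K)\<^sup>2 + \<mu> * (norm y)\<^sup>2)"
    using infdist_sq_add_ge[OF assms(1), of x K] by (simp add: le_fun_def) (smt (verit))
qed

lemma medial_axis_map_le:
  fixes x :: "'a::euclidean_space"
  assumes "\<mu> > 0"
  shows "medial_axis_map \<mu> K x \<le> (infdist x K)\<^sup>2"
proof -
  have "\<mu> / (1 + \<mu>) * (infdist x K)\<^sup>2 \<le> lower_transform \<mu> (\<lambda>y. (infdist y K)\<^sup>2) x"
    \<comment> \<open>At its base point the minorant equals \<open>\<mu> / (1 + \<mu>) * (infdist x
      K)\<^sup>2 + \<mu> * (norm x)\<^sup>2\<close>.\<close>
    using convex_envelope_greatest[OF affine_minorant[OF assms, of x K], THEN le_funD, of x]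
    by (simp add: lower_transform_def power2_norm_eq_inner)
  then have "(1 + \<mu>) * (\<mu> / (1 + \<mu>) * (infdist x K)\<^sup>2)
      \<le> (1 + \<mu>) * lower_transform \<mu> (\<lambda>y. (infdist y K)\<^sup>2) x"
    using assms by (intro mult_left_mono) auto
  moreover have "(1 + \<mu>) * (\<mu> / (1 + \<mu>) * (infdist x K)\<^sup>2) = \<mu> * (infdist x K)\<^sup>2"
    using assms by simp
  ultimately show ?thesis
    unfolding medial_axis_map_def by (simp only: right_diff_distrib) (simp add: distrib_right)
qed

text \<open>This holds for every pair of nearest points; the pair of maximal angle is chosen only in
  the final theorem.\<close>

lemma medial_axis_map_ge_nearest_points:
  fixes x :: "'a::euclidean_space"
  assumes "\<mu> > 0" "y1 \<in> nearest_points K x" "y2 \<in> nearest_points K x"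
  shows "(norm (y1 - y2))\<^sup>2 / 4 \<le> medial_axis_map \<mu> K x"
proof -
  define d where "d = infdist x K"
  define F where "F = (\<lambda>y. (infdist y K)\<^sup>2 + \<mu> * (norm y)\<^sup>2)"
  define u where "u = y1 - x"
  define v where "v = y2 - x"
  \<comment> \<open>This choice minimizes
    \<open>(1 + \<mu>) * (b \<bullet> b) - b \<bullet> (u - v)\<close>, the part of the bound below
    that depends on \<open>b\<close>.\<close>
  define b where "b = (1 / (2 * (1 + \<mu>))) *\<^sub>R (u - v)"
  define E where "E = convex_envelope F"
  have E: "convex_on UNIV E" "E \<le> F"
    unfolding E_def F_def using affine_minorant[OF assms(1)]
    by (rule convex_on_convex_envelope convex_envelope_le)+
  have F_le: "F z \<le> (norm (y - z))\<^sup>2 + \<mu> * (norm z)\<^sup>2" if "y \<in> K" for y z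
    using infdist_le[OF that, of z] infdist_nonneg[of z K]
    by (auto simp: F_def dist_norm norm_minus_commute intro!: power_mono)
  have K: "y1 \<in> K" "y2 \<in> K" and uv: "u \<bullet> u = d\<^sup>2" "v \<bullet> v = d\<^sup>2"
    using assms(2,3)
    by (auto simp: nearest_points_def u_def v_def d_def dist_norm simp flip: power2_norm_eq_inner)
  have b: "b \<bullet> (u - v) = (norm (u - v))\<^sup>2 / (2 * (1 + \<mu>))"
    "b \<bullet> b = (norm (u - v))\<^sup>2 / (4 * (1 + \<mu>)\<^sup>2)"
    by (simp_all add: b_def dot_square_norm) (simp add: power2_eq_square algebra_simps)
  have "E x = E ((1 - 1/2) *\<^sub>R (x + b) + (1/2) *\<^sub>R (x - b))"
    by (simp add: scaleR_add_right scaleR_diff_right flip: scaleR_add_left)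
  also have "\<dots> \<le> (1 - 1/2) * E (x + b) + (1/2) * E (x - b)"
    by (rule convex_onD[OF E(1)]) auto
  also have "\<dots> \<le> (1/2) * F (x + b) + (1/2) * F (x - b)"
    using E(2) by (simp add: le_fun_def add_mono)
  also have "\<dots> \<le> (1/2) * ((norm (y1 - (x + b)))\<^sup>2 + \<mu> * (norm (x + b))\<^sup>2)
      + (1/2) * ((norm (y2 - (x - b)))\<^sup>2 + \<mu> * (norm (x - b))\<^sup>2)"
    by (intro add_mono mult_left_mono F_le K) auto
  also have "\<dots> = (1/2) * ((norm (u - b))\<^sup>2 + \<mu> * (norm (x + b))\<^sup>2)
      + (1/2) * ((norm (v + b))\<^sup>2 + \<mu> * (norm (x - b))\<^sup>2)"
    by (simp add: u_def v_def algebra_simps)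
  \<comment> \<open>Averaging over \<open>x + b\<close> and \<open>x - b\<close> cancels the cross
    terms \<open>x \<bullet> b\<close>, while the opposite shifts towards \<open>y1\<close> and
    \<open>y2\<close> add up to the gain \<open>b \<bullet> (u - v)\<close>.\<close>
  also have "\<dots> = d\<^sup>2 + \<mu> * (norm x)\<^sup>2 + (1 + \<mu>) * (b \<bullet> b) - b \<bullet> (u - v)"
    using uv by (simp add: power2_norm_eq_inner inner_add inner_diff inner_commute algebra_simps)
  also have "\<dots> = d\<^sup>2 + \<mu> * (norm x)\<^sup>2 - (norm (u - v))\<^sup>2 / (4 * (1 + \<mu>))"
    unfolding b using assms(1) by (simp add: power2_eq_square divide_simps) (simp add: algebra_simps)
  finally have "(1 + \<mu>) * ((norm (u - v))\<^sup>2 / (4 * (1 + \<mu>)))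
      \<le> (1 + \<mu>) * (d\<^sup>2 + \<mu> * (norm x)\<^sup>2 - E x)"
    using assms(1) by (intro mult_left_mono) auto
  moreover have "(1 + \<mu>) * ((norm (u - v))\<^sup>2 / (4 * (1 + \<mu>))) = (norm (y1 - y2))\<^sup>2 / 4"
    using assms(1) by (simp add: u_def v_def divide_simps)
  ultimately show ?thesis
    by (simp only: medial_axis_map_def lower_transform_def E_def F_def d_def diff_diff_eq2)
qed

theorem proposition3p18:
  fixes K :: "(real ^ 'n) set" and x :: "real ^ 'n" and \<mu> :: real
  assumes "K \<noteq> {}" and "closed K" and "\<mu> > 0" and "x \<in> medial_axis K"
  shows "(sin (separation_angle K x / 2))\<^sup>2 * (infdist x K)\<^sup>2 \<le> medial_axis_map \<mu> K x
       \<and> medial_axis_map \<mu> K x \<le> (infdist x K)\<^sup>2"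
proof
  have "x \<notin> K" using assms(4) by (simp add: medial_axis_def)
  then obtain y1 y2 where y: "y1 \<in> nearest_points K x" "y2 \<in> nearest_points K x"
    and \<theta>: "separation_angle K x = vec_angle (y1 - x) (y2 - x)"
    using separation_angle_attained[OF assms(2,1)] by blast
  have "(norm (y1 - y2))\<^sup>2 = 4 * (sin (separation_angle K x / 2))\<^sup>2 * (infdist x K)\<^sup>2"
    using norm_diff_sq_eq_sin_half_vec_angle[of "y1 - x" "infdist x K" "y2 - x"] y
    by (simp add: \<theta> nearest_points_def dist_norm)
  then show "(sin (separation_angle K x / 2))\<^sup>2 * (infdist x K)\<^sup>2 \<le> medial_axis_map \<mu> K x"
    using medial_axis_map_ge_nearest_points[OF assms(3) y] by simp
  show "medial_axis_map \<mu> K x \<le> (infdist x K)\<^sup>2"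
    using assms(3) by (rule medial_axis_map_le)
qed

end
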